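(* Let $\Lambda\ge 1$ be the number of cache states and $K$ (an integer multiple of $\Lambda$) the number of users. For any values of $K$ and $\Lambda$ (with $G=\Lambda\gamma+1$), the effective coded-caching gain of the MN scheme over quasi-static Rayleigh fading satisfies $$\lim_{\rho\to 0^+}\frac{\bar R^{(\mathrm{MN})}}{\bar R^{(\mathrm{TDM})}}=1 .$$
   Context: Setting: $K$ users share $\Lambda$ cache states, $\gamma\in[0,1]$ is the normalized cache size, $\Lambda\gamma$ is an integer with $\Lambda\gamma+1\le\Lambda$, and $G:=|\mathcal G|=\Lambda\gamma+1$ is the number of users served simultaneously in one transmission stage. In the MN scheme each stage multicasts a XOR to a set $\mathcal G$ of $G$ users. The instantaneous SNRs $\mathrm{SNR}_k$ ($k\in\mathcal G$) are i.i.d. exponential random variables with mean $\rho>0$ (density $\frac1\rho e^{-x/\rho}$, $x\ge0$). The average (sum) rate of the MN scheme is $$\bar R^{(\mathrm{MN})}=\frac{G}{\ln 2}\,\mathbb E\Big\{\ln\big(1+\min_{k\in\mathcal G}\mathrm{SNR}_k\big)\Big\}.$$ It depends only on $G$ and $\rho$. The average rate $\bar R^{(\mathrm{TDM})}$ of uncoded time division multiplexing is the special case $G=1$: $\bar R^{(\mathrm{TDM})}=\frac{1}{\ln 2}\mathbb E\{\ln(1+\mathrm{SNR}_1)\}$. The effective coded-caching gain of the MN scheme is $\bar R^{(\mathrm{MN})}/\bar R^{(\mathrm{TDM})}$. *)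

theory Defs
  imports "HOL-Probability.Probability"
begin

text \<open>
  Users are natural numbers, \<open>SNR k\<close> is the instantaneous SNR of user \<open>k\<close>, a real random
  variable on \<open>M\<close>.  Rates are in bits: a XOR multicast to \<open>\<G>\<close> is limited by the weakest user
  of \<open>\<G>\<close>, and serves all of \<open>\<G>\<close> at once.
\<close>

definition avg_rate_MN :: "'a measure \<Rightarrow> (nat \<Rightarrow> 'a \<Rightarrow> real) \<Rightarrow> nat set \<Rightarrow> real" where
  "avg_rate_MN M SNR \<G> =
     real (card \<G>) / ln 2 * (\<integral>\<omega>. ln (1 + (MIN k\<in>\<G>. SNR k \<omega>)) \<partial>M)"

definition avg_rate_TDM :: "'a measure \<Rightarrow> (nat \<Rightarrow> 'a \<Rightarrow> real) \<Rightarrow> nat \<Rightarrow> real" where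
  "avg_rate_TDM M SNR k = 1 / ln 2 * (\<integral>\<omega>. ln (1 + SNR k \<omega>) \<partial>M)"

lemma avg_rate_TDM_eq_MN: "avg_rate_TDM M SNR k = avg_rate_MN M SNR {k}"
  by (simp add: avg_rate_TDM_def avg_rate_MN_def)

definition effective_gain_MN ::
    "'a measure \<Rightarrow> (nat \<Rightarrow> 'a \<Rightarrow> real) \<Rightarrow> nat set \<Rightarrow> nat \<Rightarrow> real" where
  "effective_gain_MN M SNR \<G> k = avg_rate_MN M SNR \<G> / avg_rate_TDM M SNR k"

text \<open>
  Quasi-static Rayleigh fading with mean SNR \<open>\<rho>\<close>: every user of \<open>U\<close> has an exponential SNR.
  The parameter of \<^const>\<open>erlang_density\<close> \<open>0\<close>, i.e. of the exponential density, is the rate,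
  so mean \<open>\<rho>\<close> corresponds to \<open>1 / \<rho>\<close>.  Independence is required only among the users of \<open>\<G>\<close>,
  which are served simultaneously.
\<close>

definition rayleigh_fading ::
    "'a measure \<Rightarrow> (nat \<Rightarrow> 'a \<Rightarrow> real) \<Rightarrow> nat set \<Rightarrow> nat set \<Rightarrow> real \<Rightarrow> bool" where
  "rayleigh_fading M SNR U \<G> \<rho> \<longleftrightarrow>
     prob_space M \<and>
     (\<forall>k\<in>U. distributed M lborel (SNR k) (exponential_density (1 / \<rho>))) \<and>
     prob_space.indep_vars M (\<lambda>_. borel) SNR \<G>"

end

theory Submission
  imports Defs
begin

text \<open>
  The minimum of \<open>G\<close> independent exponential SNRs of mean \<open>\<rho>\<close> is exponential of mean \<open>\<rho> / G\<close>, and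
  the expectation of \<open>ln (1 + X)\<close> is the mean of \<open>X\<close> to first order in that mean.  The factor
  \<open>G\<close> gained by multicasting is thus cancelled by the loss \<open>1 / G\<close> in the SNR of the weakest user.
\<close>

text \<open>The range \<open>x > 1\<close> is included because an exponential variable is unbounded;
  there the left-hand side is negative.\<close>

lemma ln_one_plus_ge_quadratic:
  fixes x :: real
  assumes "0 \<le> x"
  shows "x - x\<^sup>2 \<le> ln (1 + x)"
proof (cases "x \<le> 1")
  case True
  with assms show ?thesis by (rule ln_one_plus_pos_lower_bound)
next
  case False
  then have "x \<le> x\<^sup>2" by (simp add: power2_eq_square)
  moreover have "0 \<le> ln (1 + x)" using assms by simp
  ultimately show ?thesis by linarith
qed

text \<open>Integrate \<open>x - x\<^sup>2 \<le> ln (1 + x) \<le> x\<close> over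
  \<open>x \<ge> 0\<close>; the first two moments of \<open>X\<close> are \<open>1 / l\<close> and
  \<open>2 / l\<^sup>2\<close>.\<close>

lemma (in prob_space) exponential_expectation_ln_bounds:
  assumes l: "0 < l" and D: "distributed M lborel X (exponential_density l)"
  shows "expectation (\<lambda>x. ln (1 + X x)) \<le> 1 / l"
    and "1 / l - 2 / l\<^sup>2 \<le> expectation (\<lambda>x. ln (1 + X x))"
proof -
  have [measurable]: "X \<in> borel_measurable M"
    using distributed_measurable[OF D] by simp
  \<comment> \<open>The density vanishes below 0, so nonnegativity holds almost surely, though not
    necessarily pointwise.\<close>
  have nonneg: "AE x in M. 0 \<le> X x"
    by (subst distributed_AE2[OF D]) (auto simp: erlang_density_def)
  have X: "integrable M X" "integrable M (\<lambda>x. (X x)\<^sup>2)"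
    using erlang_ith_moment_integrable[OF l D, of 1] erlang_ith_moment_integrable[OF l D, of 2]
    by simp_all
  have EX: "expectation X = 1 / l" "expectation (\<lambda>x. (X x)\<^sup>2) = 2 / l\<^sup>2"
    using erlang_ith_moment[OF l D, of 1] erlang_ith_moment[OF l D, of 2] by simp_all
  have L: "integrable M (\<lambda>x. ln (1 + X x))"
    using X(1)
  proof (rule Bochner_Integration.integrable_bound)
    show "AE x in M. norm (ln (1 + X x)) \<le> norm (X x)"
      using nonneg by eventually_elim (simp add: ln_add_one_self_le_self)
  qed simp
  have "expectation (\<lambda>x. ln (1 + X x)) \<le> expectation X"
    using nonneg by (intro integral_mono_AE L X) (auto elim!: eventually_mono intro: ln_add_one_self_le_self)
  then show "expectation (\<lambda>x. ln (1 + X x)) \<le> 1 / l" by (simp add: EX)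
  have "expectation (\<lambda>x. X x - (X x)\<^sup>2) \<le> expectation (\<lambda>x. ln (1 + X x))"
    using nonneg
    by (intro integral_mono_AE L X Bochner_Integration.integrable_diff)
      (auto elim!: eventually_mono intro: ln_one_plus_ge_quadratic)
  then show "1 / l - 2 / l\<^sup>2 \<le> expectation (\<lambda>x. ln (1 + X x))"
    by (simp add: X EX)
qed

text \<open>The prefactor \<open>card \<G>\<close> cancels the same factor in the mean of the
  minimum, so the size of \<open>\<G>\<close> survives only in the term of second order in
  \<open>\<rho>\<close>.\<close>

lemma avg_rate_MN_bounds:
  assumes "0 < \<rho>" and fading: "rayleigh_fading M SNR U \<G> \<rho>"
    and "\<G> \<subseteq> U" "finite \<G>" "\<G> \<noteq> {}"
  shows "avg_rate_MN M SNR \<G> \<le> \<rho> / ln 2"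
    and "(\<rho> - 2 * \<rho>\<^sup>2 / real (card \<G>)) / ln 2 \<le> avg_rate_MN M SNR \<G>"
proof -
  interpret prob_space M using fading by (simp add: rayleigh_fading_def)
  let ?G = "real (card \<G>)"
  let ?E = "expectation (\<lambda>\<omega>. ln (1 + (MIN k\<in>\<G>. SNR k \<omega>)))"
  have G: "0 < ?G" using assms by (simp add: card_gt_0_iff)
  \<comment> \<open>Tail probabilities of independent variables multiply, so the rates of the
    exponentials add up under the minimum.\<close>
  have "distributed M lborel (\<lambda>\<omega>. MIN k\<in>\<G>. SNR k \<omega>) (exponential_density (\<Sum>k\<in>\<G>. 1 / \<rho>))"
    using assms by (intro exponential_distributed_Min) (auto simp: rayleigh_fading_def)
  then have "distributed M lborel (\<lambda>\<omega>. MIN k\<in>\<G>. SNR k \<omega>) (exponential_density (?G / \<rho>))"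
    by simp
  from exponential_expectation_ln_bounds[OF _ this]
  have "?E \<le> \<rho> / ?G" "\<rho> / ?G - 2 * \<rho>\<^sup>2 / ?G\<^sup>2 \<le> ?E"
    using G \<open>0 < \<rho>\<close> by (simp_all add: power_divide)
  from this[THEN mult_left_mono, of ?G]
  have "?G * ?E \<le> \<rho>" "\<rho> - 2 * \<rho>\<^sup>2 / ?G \<le> ?G * ?E"
    using G by (simp_all add: right_diff_distrib power2_eq_square)
  then show "avg_rate_MN M SNR \<G> \<le> \<rho> / ln 2"
    and "(\<rho> - 2 * \<rho>\<^sup>2 / ?G) / ln 2 \<le> avg_rate_MN M SNR \<G>"
    unfolding avg_rate_MN_def by (simp_all add: divide_right_mono)
qed

text \<open>The limit is the same for every nonempty finite \<open>\<G>\<close>, so it covers both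
  the multicast group and the single TDM user. The probability space may change with
  \<open>\<rho>\<close>, since the bounds hold for each \<open>\<rho>\<close> separately.\<close>

lemma avg_rate_MN_asymptotics:
  assumes fading: "\<And>\<rho>. 0 < \<rho> \<Longrightarrow> rayleigh_fading (M \<rho>) (SNR \<rho>) U \<G> \<rho>"
    and "\<G> \<subseteq> U" "finite \<G>" "\<G> \<noteq> {}"
  shows "((\<lambda>\<rho>. avg_rate_MN (M \<rho>) (SNR \<rho>) \<G> / \<rho>) \<longlongrightarrow> 1 / ln 2) (at_right 0)"
proof (rule tendsto_sandwich)
  let ?G = "real (card \<G>)"
  have pos: "\<forall>\<^sub>F \<rho>::real in at_right 0. 0 < \<rho>"
    by (simp add: eventually_at_right_less)
  show "\<forall>\<^sub>F \<rho> in at_right 0. (1 - 2 * \<rho> / ?G) / ln 2 \<le> avg_rate_MN (M \<rho>) (SNR \<rho>) \<G> / \<rho>"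
    using pos
  proof eventually_elim
    case (elim \<rho>)
    then have "(1 - 2 * \<rho> / ?G) / ln 2 = (\<rho> - 2 * \<rho>\<^sup>2 / ?G) / ln 2 / \<rho>"
      by (simp add: diff_divide_distrib power2_eq_square)
    also have "\<dots> \<le> avg_rate_MN (M \<rho>) (SNR \<rho>) \<G> / \<rho>"
      using avg_rate_MN_bounds(2)[OF elim fading[OF elim] assms(2-4)] elim
      by (intro divide_right_mono) auto
    finally show ?case .
  qed
  show "\<forall>\<^sub>F \<rho> in at_right 0. avg_rate_MN (M \<rho>) (SNR \<rho>) \<G> / \<rho> \<le> 1 / ln 2"
    using pos
  proof eventually_elim
    case (elim \<rho>)
    then show ?case
      using avg_rate_MN_bounds(1)[OF elim fading[OF elim] assms(2-4)]
      by (simp add: field_simps)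
  qed
  show "((\<lambda>\<rho>. (1 - 2 * \<rho> / ?G) / ln 2) \<longlongrightarrow> 1 / ln 2) (at_right 0)"
    by (auto intro!: tendsto_eq_intros simp: divide_inverse)
qed simp

text \<open>This makes TDM an instance of the multicast estimates, even for a user outside
  \<open>\<G>\<close>.\<close>

lemma rayleigh_fading_singleton:
  assumes "rayleigh_fading M SNR U \<G> \<rho>" and "k \<in> U"
  shows "rayleigh_fading M SNR U {k} \<rho>"
proof -
  interpret prob_space M using assms by (simp add: rayleigh_fading_def)
  have "distributed M lborel (SNR k) (exponential_density (1 / \<rho>))"
    using assms by (simp add: rayleigh_fading_def)
  from distributed_measurable[OF this] have "SNR k \<in> borel_measurable M"
    by simp
  \<comment> \<open>The only nonempty subset of \<open>{k}\<close> is \<open>{k}\<close> itself,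
    where the product formula is trivial; what remains is measurability.\<close>
  then have "indep_vars (\<lambda>_. borel) SNR {k}"
    unfolding indep_vars_def2 by (auto intro!: indep_setsI dest!: subset_singletonD)
  then show ?thesis using assms by (simp add: rayleigh_fading_def)
qed

theorem proposition2:
  fixes K \<Lambda> :: nat and \<gamma> :: real
    and \<G> :: "nat set" and k\<^sub>0 :: nat
    and M :: "real \<Rightarrow> 'a measure"
    and SNR :: "real \<Rightarrow> nat \<Rightarrow> 'a \<Rightarrow> real"
  assumes "\<Lambda> \<ge> 1" and "K \<ge> 1" and "\<Lambda> dvd K"
    and "0 \<le> \<gamma>" and "\<gamma> \<le> 1"
    and "real \<Lambda> * \<gamma> \<in> \<int>" and "real \<Lambda> * \<gamma> + 1 \<le> real \<Lambda>"
    and "\<G> \<subseteq> {1..K}" and "real (card \<G>) = real \<Lambda> * \<gamma> + 1"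
    and "k\<^sub>0 \<in> {1..K}"
    and "\<And>\<rho>. \<rho> > 0 \<Longrightarrow> rayleigh_fading (M \<rho>) (SNR \<rho>) {1..K} \<G> \<rho>"
  shows "((\<lambda>\<rho>. effective_gain_MN (M \<rho>) (SNR \<rho>) \<G> k\<^sub>0) \<longlongrightarrow> 1) (at_right 0)"
proof -
  let ?MN = "\<lambda>\<rho>. avg_rate_MN (M \<rho>) (SNR \<rho>) \<G>"
  let ?TDM = "\<lambda>\<rho>. avg_rate_TDM (M \<rho>) (SNR \<rho>) k\<^sub>0"
  note fading = assms(11)
  have "0 < real (card \<G>)"
    using assms(4,9) by (simp add: add_nonneg_pos)
  \<comment> \<open>An infinite set has \<open>card\<close> equal to 0, so positivity also gives
    finiteness.\<close>
  then have "finite \<G>" "\<G> \<noteq> {}"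
    by (auto simp: card_gt_0_iff)
  with fading \<open>\<G> \<subseteq> {1..K}\<close> have "((\<lambda>\<rho>. ?MN \<rho> / \<rho>) \<longlongrightarrow> 1 / ln 2) (at_right 0)"
    by (intro avg_rate_MN_asymptotics)
  moreover have "((\<lambda>\<rho>. ?TDM \<rho> / \<rho>) \<longlongrightarrow> 1 / ln 2) (at_right 0)"
    unfolding avg_rate_TDM_eq_MN
  proof (rule avg_rate_MN_asymptotics)
    show "rayleigh_fading (M \<rho>) (SNR \<rho>) {1..K} {k\<^sub>0} \<rho>" if "0 < \<rho>" for \<rho>
      using fading[OF that] \<open>k\<^sub>0 \<in> {1..K}\<close> by (rule rayleigh_fading_singleton)
  qed (use \<open>k\<^sub>0 \<in> {1..K}\<close> in auto)
  ultimately have "((\<lambda>\<rho>. (?MN \<rho> / \<rho>) / (?TDM \<rho> / \<rho>)) \<longlongrightarrow> (1 / ln 2) / (1 / ln 2)) (at_right 0)"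
    by (rule tendsto_divide) simp
  \<comment> \<open>The common factor \<open>1 / \<rho>\<close> cancels for
    \<open>\<rho> > 0\<close>, which is all that the one-sided limit sees.\<close>
  moreover have "\<forall>\<^sub>F \<rho> in at_right 0.
      (?MN \<rho> / \<rho>) / (?TDM \<rho> / \<rho>) = effective_gain_MN (M \<rho>) (SNR \<rho>) \<G> k\<^sub>0"
    using eventually_at_right_less[of "0::real"]
    by eventually_elim (simp add: effective_gain_MN_def)
  ultimately show ?thesis
    by (simp add: tendsto_cong)
qed

end
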